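(* Let $p\ge1$ and $d\ge 2$ be integers and let $G$ be a finite subgroup of the orthogonal group $O(\mathbb{R}^d)$. The following conditions are equivalent: (1) For all $1\le k<d$ and all $k$-dimensional linear subspaces $V$ of $\mathbb{R}^d$, the collection $G.V:=\{g(V):g\in G\}$ is a tight $p$-fusion frame (with all weights equal to $1$). (2) $\big(\mathbb{R}[X_1,\dots,X_d]_{2p}\big)^G=\mathbb{R}\,(X_1^2+\dots+X_d^2)^p$.
   Context: A finite collection $\{V_j\}_{j=1}^n$ of linear subspaces of $\mathbb{R}^d$ is a tight $p$-fusion frame (with all weights equal to $1$) if there is a constant $A>0$ such that $\sum_{j=1}^n\|P_{V_j}(x)\|^{2p}=A\|x\|^{2p}$ for all $x\in\mathbb{R}^d$, where $P_V$ is the orthogonal projection onto $V$. $\mathbb{R}[X_1,\dots,X_d]_{2p}$ denotes the space of homogeneous polynomials of degree $2p$ in $d$ variables, and $\big(\mathbb{R}[X_1,\dots,X_d]_{2p}\big)^G$ denotes the subspace of those $P$ with $P(\underline{X}M)=P(\underline{X})$ for all $M\in G$, where $\underline{X}=(X_1,\dots,X_d)$ and elements of $G$ are regarded as orthogonal matrices. *)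

theory Defs
  imports
    "HOL-Analysis.Analysis"
    "HOL-Algebra.Group"
    "HOL-Library.Poly_Mapping"
begin

definition orthogonal_group :: "(real ^ 'n ^ 'n) monoid" where
  "orthogonal_group = \<lparr>carrier = {M. orthogonal_matrix M}, mult = (**), one = mat 1\<rparr>"

lemma group_orthogonal_group: "group orthogonal_group"
proof (rule groupI)
  fix M :: "real ^ 'n ^ 'n" assume "M \<in> carrier orthogonal_group"
  then show "\<exists>N\<in>carrier orthogonal_group. N \<otimes>\<^bsub>orthogonal_group\<^esub> M = \<one>\<^bsub>orthogonal_group\<^esub>"
    by (intro bexI[of _ "transpose M"])
       (auto simp: orthogonal_group_def orthogonal_matrix_def)
qed (auto simp: orthogonal_group_def orthogonal_matrix_mul orthogonal_matrix_id matrix_mul_assoc)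

definition orthogonal_projection :: "'a::real_inner set \<Rightarrow> 'a \<Rightarrow> 'a" where
  "orthogonal_projection V x = (THE y. y \<in> V \<and> (\<forall>v\<in>V. orthogonal (x - y) v))"

lemma orthogonal_projection:
  fixes V :: "'a::euclidean_space set"
  assumes "subspace V"
  shows "orthogonal_projection V x \<in> V"
    and "\<forall>v\<in>V. orthogonal (x - orthogonal_projection V x) v"
proof -
  let ?P = "\<lambda>y. y \<in> V \<and> (\<forall>v\<in>V. orthogonal (x - y) v)"
  have sp: "span V = V"
    using assms by (simp add: span_eq_iff)
  obtain y z where "y \<in> V" "\<And>w. w \<in> V \<Longrightarrow> orthogonal z w" "x = y + z"
    using orthogonal_subspace_decomp_exists[of V x] sp by metis
  then have ex: "?P y" by simp
  have "?P (orthogonal_projection V x)"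
    unfolding orthogonal_projection_def
  proof (rule theI)
    show "?P y" by (rule ex)
    fix y' assume y': "?P y'"
    then have "y' - y \<in> V"
      using ex assms by (simp add: subspace_diff)
    then have "(x - y) \<bullet> (y' - y) = 0" "(x - y') \<bullet> (y' - y) = 0"
      using ex y' by (auto simp: orthogonal_def)
    then have "(y' - y) \<bullet> (y' - y) = 0"
      by (simp add: inner_diff_left)
    then show "y' = y" by simp
  qed
  then show "orthogonal_projection V x \<in> V"
    and "\<forall>v\<in>V. orthogonal (x - orthogonal_projection V x) v" by auto
qed

text \<open>All weights are 1. The family is indexed, so the same subspace may occur repeatedly.\<close>

definition tight_fusion_frame ::
  "nat \<Rightarrow> 'i set \<Rightarrow> ('i \<Rightarrow> 'a::euclidean_space set) \<Rightarrow> bool" where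
  "tight_fusion_frame p I V \<longleftrightarrow>
     finite I \<and> (\<forall>i\<in>I. subspace (V i)) \<and>
     (\<exists>A>0. \<forall>x. (\<Sum>i\<in>I. norm (orthogonal_projection (V i) x) ^ (2 * p)) = A * norm x ^ (2 * p))"

definition subspace_orbit :: "(real ^ 'n ^ 'n) set \<Rightarrow> (real ^ 'n) set \<Rightarrow> (real ^ 'n) set set" where
  "subspace_orbit G V = {(*v) g ` V | g. g \<in> G}"

text \<open>Polynomials with coefficients in \<open>'a\<close> in variables indexed by \<open>'n\<close>: finitely supported maps
  from exponent vectors to coefficients, with the convolution product of
  \<^theory>\<open>HOL-Library.Poly_Mapping\<close>.\<close>

type_synonym ('n, 'a) mpoly = "('n \<Rightarrow>\<^sub>0 nat) \<Rightarrow>\<^sub>0 'a"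

definition Const :: "'a::zero \<Rightarrow> ('n, 'a) mpoly" where
  "Const c = Poly_Mapping.single 0 c"

definition Var :: "'n \<Rightarrow> ('n, 'a::zero_neq_one) mpoly" where
  "Var i = Poly_Mapping.single (Poly_Mapping.single i 1) 1"

definition homogeneous_polys :: "nat \<Rightarrow> ('n::finite, 'a::zero) mpoly set" where
  "homogeneous_polys m = {P. \<forall>\<alpha>\<in>Poly_Mapping.keys P. (\<Sum>i\<in>UNIV. Poly_Mapping.lookup \<alpha> i) = m}"

definition poly_subst ::
  "('n::finite, 'a::comm_ring_1) mpoly \<Rightarrow> ('n \<Rightarrow> ('n, 'a) mpoly) \<Rightarrow> ('n, 'a) mpoly" where
  "poly_subst P F = (\<Sum>\<alpha>\<in>Poly_Mapping.keys P. Const (Poly_Mapping.lookup P \<alpha>) * (\<Prod>i\<in>UNIV. F i ^ Poly_Mapping.lookup \<alpha> i))"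

text \<open>\<open>row_times M\<close> is the row vector of variables multiplied by \<open>M\<close> on the right.\<close>

definition row_times :: "'a::comm_ring_1 ^ 'n ^ 'n \<Rightarrow> 'n::finite \<Rightarrow> ('n, 'a) mpoly" where
  "row_times M j = (\<Sum>i\<in>UNIV. Var i * Const (M $ i $ j))"

definition invariant_homogeneous_polys ::
  "nat \<Rightarrow> ('a::comm_ring_1 ^ 'n::finite ^ 'n) set \<Rightarrow> ('n, 'a) mpoly set" where
  "invariant_homogeneous_polys m G =
     {P \<in> homogeneous_polys m. \<forall>M\<in>G. poly_subst P (row_times M) = P}"

end

theory Submission
  imports Defs
begin

text \<open>
Both conditions are translated into statements about polynomial functions, which is
faithful because a real polynomial is determined by its values (\<open>eval_mpoly_inject\<close>).

From invariants to frames: for a subspace \<open>V\<close>, the function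
\<open>x \<mapsto> \<Sum>W. \<parallel>P\<^sub>W x\<parallel>^(2p)\<close>, summed over the orbit of \<open>V\<close>, is a homogeneous polynomial of degree \<open>2p\<close>,
since \<open>\<parallel>P\<^sub>W x\<parallel>^2\<close> is a quadratic form. The group permutes the orbit, so the polynomial is invariant and
therefore a multiple \<open>c \<parallel>x\<parallel>^(2p)\<close>. Evaluating at a nonzero \<open>x \<in> V\<close>, where \<open>P\<^sub>V x = x\<close>, shows \<open>c > 0\<close>.

From frames to invariants: lines are enough. For the line through \<open>v\<close> the frame condition says that
\<open>\<Sum>g. \<langle>g x, v\<rangle>^(2p)\<close> is \<open>\<parallel>x\<parallel>^(2p)\<close> times a factor independent of \<open>x\<close>; the factor is found by putting a fixed
unit vector \<open>e\<close> for \<open>x\<close> (\<open>sum_group_inner_power\<close>). The resulting identity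
\<open>\<Sum>g. \<langle>g x, v\<rangle>^(2p) = \<parallel>x\<parallel>^(2p) * \<Sum>g. \<langle>g e, v\<rangle>^(2p)\<close> holds for all \<open>v\<close>. Comparing coefficients of the
monomials in \<open>v\<close> replaces \<open>\<langle>_, v\<rangle>^(2p)\<close> by an arbitrary monomial of degree \<open>2p\<close>, and hence by an arbitrary
homogeneous polynomial \<open>P\<close> (\<open>equal_power_sums_imp_equal_homogeneous_sums\<close>). If \<open>P\<close> is invariant, all
summands agree, and the identity reads \<open>P(x) = \<parallel>x\<parallel>^(2p) * P(e)\<close>.
\<close>

section \<open>Evaluation of polynomials\<close>

definition monomial_at :: "('n::finite \<Rightarrow>\<^sub>0 nat) \<Rightarrow> 'a::comm_ring_1 ^ 'n \<Rightarrow> 'a" where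
  "monomial_at \<alpha> x = (\<Prod>i\<in>UNIV. x $ i ^ Poly_Mapping.lookup \<alpha> i)"

definition eval_mpoly :: "('n::finite, 'a::comm_ring_1) mpoly \<Rightarrow> 'a ^ 'n \<Rightarrow> 'a" where
  "eval_mpoly P x = (\<Sum>\<alpha>\<in>Poly_Mapping.keys P. Poly_Mapping.lookup P \<alpha> * monomial_at \<alpha> x)"

lemma monomial_at_add: "monomial_at (\<alpha> + \<beta>) x = monomial_at \<alpha> x * monomial_at \<beta> x"
  by (simp add: monomial_at_def lookup_add power_add prod.distrib)

lemma eval_mpoly_superset:
  assumes "finite A" "Poly_Mapping.keys P \<subseteq> A"
  shows "eval_mpoly P x = (\<Sum>\<alpha>\<in>A. Poly_Mapping.lookup P \<alpha> * monomial_at \<alpha> x)"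
  unfolding eval_mpoly_def
  by (rule sum.mono_neutral_left) (use assms in \<open>auto simp: in_keys_iff\<close>)

lemma eval_mpoly_add: "eval_mpoly (P + Q) x = eval_mpoly P x + eval_mpoly Q x"
proof -
  let ?A = "Poly_Mapping.keys P \<union> Poly_Mapping.keys Q"
  have "Poly_Mapping.keys (P + Q) \<subseteq> ?A" by (rule keys_add)
  then show ?thesis
    by (simp add: eval_mpoly_superset[of ?A] lookup_add distrib_right sum.distrib)
qed

lemma eval_mpoly_0: "eval_mpoly 0 x = 0"
  by (simp add: eval_mpoly_def)

lemma eval_mpoly_single: "eval_mpoly (Poly_Mapping.single \<alpha> c) x = c * monomial_at \<alpha> x"
  by (subst eval_mpoly_superset[of "{\<alpha>}"]) auto

lemma eval_mpoly_Const: "eval_mpoly (Const c) x = c"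
  by (simp add: Const_def eval_mpoly_single monomial_at_def)

lemma eval_mpoly_Var: "eval_mpoly (Var i) x = x $ i"
proof -
  have "(\<Prod>j\<in>UNIV. x $ j ^ Poly_Mapping.lookup (Poly_Mapping.single i 1) j)
      = (\<Prod>j\<in>UNIV. if j = i then x $ j else 1)"
    by (rule prod.cong) (auto simp: lookup_single when_def)
  then show ?thesis
    by (simp add: Var_def eval_mpoly_single monomial_at_def)
qed

lemma eval_mpoly_sum: "eval_mpoly (\<Sum>j\<in>J. P j) x = (\<Sum>j\<in>J. eval_mpoly (P j) x)"
  by (induction J rule: infinite_finite_induct) (auto simp: eval_mpoly_0 eval_mpoly_add)

lemma sum_single_lookup:
  "(\<Sum>\<alpha>\<in>Poly_Mapping.keys P. Poly_Mapping.single \<alpha> (Poly_Mapping.lookup P \<alpha>)) = P"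
  by (rule poly_mapping_eqI) (auto simp: lookup_sum lookup_single when_def in_keys_iff)

lemma eval_mpoly_mult: "eval_mpoly (P * Q) x = eval_mpoly P x * eval_mpoly Q x"
proof -
  let ?l = Poly_Mapping.lookup
  have "P * Q = (\<Sum>\<alpha>\<in>Poly_Mapping.keys P. \<Sum>\<beta>\<in>Poly_Mapping.keys Q.
      Poly_Mapping.single (\<alpha> + \<beta>) (?l P \<alpha> * ?l Q \<beta>))"
    by (subst (1 2) sum_single_lookup[symmetric]) (simp only: sum_product mult_single)
  then show ?thesis
    by (simp add: eval_mpoly_sum eval_mpoly_single monomial_at_add)
      (simp add: eval_mpoly_def sum_product mult_ac)
qed

lemma Const_1: "Const 1 = 1"
  by (simp add: Const_def)

lemma eval_mpoly_1: "eval_mpoly 1 x = 1"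
  by (simp add: eval_mpoly_Const flip: Const_1)

lemma eval_mpoly_prod: "eval_mpoly (\<Prod>j\<in>J. P j) x = (\<Prod>j\<in>J. eval_mpoly (P j) x)"
  by (induction J rule: infinite_finite_induct) (auto simp: eval_mpoly_1 eval_mpoly_mult)

lemma eval_mpoly_power: "eval_mpoly (P ^ n) x = eval_mpoly P x ^ n"
  by (induction n) (auto simp: eval_mpoly_1 eval_mpoly_mult)

lemmas eval_mpoly_simps = eval_mpoly_0 eval_mpoly_1 eval_mpoly_Const eval_mpoly_Var
  eval_mpoly_add eval_mpoly_mult eval_mpoly_sum eval_mpoly_prod eval_mpoly_power

lemma eval_mpoly_subst:
  "eval_mpoly (poly_subst P F) x = eval_mpoly P (\<chi> i. eval_mpoly (F i) x)"
  by (simp add: poly_subst_def eval_mpoly_simps) (simp add: eval_mpoly_def monomial_at_def)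

lemma eval_mpoly_row_times: "eval_mpoly (row_times M j) x = (transpose M *v x) $ j"
  by (simp add: row_times_def eval_mpoly_simps matrix_vector_mult_def transpose_def mult.commute)

text \<open>
Substituting the row \<open>X M\<close> evaluates at the row vector \<open>x M\<close>, which as a column is
\<open>transpose M *v x\<close>. As an orthogonal group contains the transposes of its elements, invariance under
all these substitutions is invariance of the polynomial function under the group.
\<close>

lemma eval_mpoly_subst_row_times:
  "eval_mpoly (poly_subst P (row_times M)) x = eval_mpoly P (transpose M *v x)"
  by (simp add: eval_mpoly_subst eval_mpoly_row_times)

text \<open>
Linear independence of monomials, one variable at a time: sorting the terms by the exponent of the new
variable gives a univariate polynomial, whose coefficients must vanish. While only the variables in \<open>S\<close>
have been treated, exponent vectors that agree on \<open>S\<close> cannot be told apart, so the conclusion concerns the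
sum of their coefficients; for \<open>S = UNIV\<close> this sum has at most one term.
\<close>

lemma polynomial_function_zero_imp_coeffs_zero:
  fixes a :: "('n \<Rightarrow>\<^sub>0 nat) \<Rightarrow> real"
  assumes "finite S" "finite A"
    and "\<And>x :: 'n \<Rightarrow> real. (\<Sum>\<alpha>\<in>A. a \<alpha> * (\<Prod>i\<in>S. x i ^ Poly_Mapping.lookup \<alpha> i)) = 0"
  shows "(\<Sum>\<alpha> | \<alpha> \<in> A \<and> (\<forall>i\<in>S. Poly_Mapping.lookup \<alpha> i = Poly_Mapping.lookup \<beta> i). a \<alpha>) = 0"
  using assms
proof (induction S arbitrary: A rule: finite_induct)
  case empty
  then show ?case by simp
next
  case (insert i S)
  let ?l = Poly_Mapping.lookup
  let ?k = "?l \<beta> i"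
  let ?B = "{\<alpha>\<in>A. ?l \<alpha> i = ?k}"
  have "(\<Sum>\<alpha>\<in>?B. a \<alpha> * (\<Prod>j\<in>S. x j ^ ?l \<alpha> j)) = 0" for x :: "'n \<Rightarrow> real"
  proof -
    define N where "N = Max (insert ?k ((\<lambda>\<alpha>. ?l \<alpha> i) ` A))"
    define b where "b k = (\<Sum>\<alpha> | \<alpha> \<in> A \<and> ?l \<alpha> i = k. a \<alpha> * (\<Prod>j\<in>S. x j ^ ?l \<alpha> j))" for k
    have N: "(\<lambda>\<alpha>. ?l \<alpha> i) ` A \<subseteq> {..N}" "?k \<le> N"
      using insert.prems(1) by (auto simp: N_def)
    have "(\<Sum>k\<le>N. b k * t ^ k) = 0" for t
    proof -
      have "(\<Sum>k\<le>N. b k * t ^ k)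
          = (\<Sum>k\<le>N. \<Sum>\<alpha> | \<alpha> \<in> A \<and> ?l \<alpha> i = k. a \<alpha> * (\<Prod>j\<in>S. x j ^ ?l \<alpha> j) * t ^ ?l \<alpha> i)"
        unfolding b_def sum_distrib_right by (intro sum.cong) auto
      also have "\<dots> = (\<Sum>\<alpha>\<in>A. a \<alpha> * (\<Prod>j\<in>S. x j ^ ?l \<alpha> j) * t ^ ?l \<alpha> i)"
        by (rule sum.group) (use insert.prems(1) N in auto)
      also have "\<dots> = (\<Sum>\<alpha>\<in>A. a \<alpha> * (\<Prod>j\<in>insert i S. (x(i := t)) j ^ ?l \<alpha> j))"
      proof (rule sum.cong[OF refl])
        fix \<alpha>
        have "(\<Prod>j\<in>S. (x(i := t)) j ^ ?l \<alpha> j) = (\<Prod>j\<in>S. x j ^ ?l \<alpha> j)"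
          using insert.hyps(2) by (intro prod.cong) auto
        then show "a \<alpha> * (\<Prod>j\<in>S. x j ^ ?l \<alpha> j) * t ^ ?l \<alpha> i
            = a \<alpha> * (\<Prod>j\<in>insert i S. (x(i := t)) j ^ ?l \<alpha> j)"
          using insert.hyps by simp
      qed
      also have "\<dots> = 0" by (rule insert.prems(2))
      finally show ?thesis .
    qed
    then have "b ?k = 0"
      using N(2) polyfun_eq_0[of b N] by blast
    then show ?thesis by (simp add: b_def)
  qed
  then have "(\<Sum>\<alpha> | \<alpha> \<in> ?B \<and> (\<forall>j\<in>S. ?l \<alpha> j = ?l \<beta> j). a \<alpha>) = 0"
    using insert.prems(1) by (intro insert.IH) auto
  moreover have "{\<alpha>. \<alpha> \<in> ?B \<and> (\<forall>j\<in>S. ?l \<alpha> j = ?l \<beta> j)}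
      = {\<alpha>. \<alpha> \<in> A \<and> (\<forall>j\<in>insert i S. ?l \<alpha> j = ?l \<beta> j)}"
    by auto
  ultimately show ?case by simp
qed

lemma eval_mpoly_inject:
  fixes P Q :: "('n::finite, real) mpoly"
  assumes "\<And>x. eval_mpoly P x = eval_mpoly Q x"
  shows "P = Q"
proof (rule poly_mapping_eqI)
  fix \<beta> :: "'n \<Rightarrow>\<^sub>0 nat"
  let ?l = Poly_Mapping.lookup
  define A where "A = insert \<beta> (Poly_Mapping.keys P \<union> Poly_Mapping.keys Q)"
  have A: "finite A" "Poly_Mapping.keys P \<subseteq> A" "Poly_Mapping.keys Q \<subseteq> A" "\<beta> \<in> A"
    by (auto simp: A_def)
  have "(\<Sum>\<alpha>\<in>A. (?l P \<alpha> - ?l Q \<alpha>) * (\<Prod>i\<in>UNIV. x i ^ ?l \<alpha> i)) = 0" for x :: "'n \<Rightarrow> real"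
    using assms[of "\<chi> i. x i"] A
    by (simp add: eval_mpoly_superset[of A] monomial_at_def left_diff_distrib sum_subtractf)
  from polynomial_function_zero_imp_coeffs_zero[OF finite[of UNIV] A(1) this, of \<beta>]
  have "(\<Sum>\<alpha> | \<alpha> \<in> A \<and> (\<forall>i. ?l \<alpha> i = ?l \<beta> i). ?l P \<alpha> - ?l Q \<alpha>) = 0" by simp
  moreover have "{\<alpha>. \<alpha> \<in> A \<and> (\<forall>i. ?l \<alpha> i = ?l \<beta> i)} = {\<beta>}"
    using A(4) by (auto intro: poly_mapping_eqI)
  ultimately show "?l P \<beta> = ?l Q \<beta>" by simp
qed

section \<open>Homogeneous polynomials\<close>

lemma homogeneous_polys_add:
  "P \<in> homogeneous_polys m \<Longrightarrow> Q \<in> homogeneous_polys m \<Longrightarrow> P + Q \<in> homogeneous_polys m"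
  using keys_add[of P Q] by (auto simp: homogeneous_polys_def)

lemma homogeneous_polys_0: "0 \<in> homogeneous_polys m"
  by (simp add: homogeneous_polys_def)

lemma homogeneous_polys_sum:
  "(\<And>j. j \<in> J \<Longrightarrow> P j \<in> homogeneous_polys m) \<Longrightarrow> (\<Sum>j\<in>J. P j) \<in> homogeneous_polys m"
  by (induction J rule: infinite_finite_induct) (auto simp: homogeneous_polys_add homogeneous_polys_0)

lemma homogeneous_polys_mult:
  assumes "P \<in> homogeneous_polys m" "Q \<in> homogeneous_polys n"
  shows "P * Q \<in> homogeneous_polys (m + n)"
  unfolding homogeneous_polys_def
proof (intro CollectI ballI)
  fix \<gamma> assume "\<gamma> \<in> Poly_Mapping.keys (P * Q)"
  then obtain \<alpha> \<beta> where "\<alpha> \<in> Poly_Mapping.keys P" "\<beta> \<in> Poly_Mapping.keys Q" "\<gamma> = \<alpha> + \<beta>"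
    using keys_mult[of P Q] by blast
  then show "(\<Sum>i\<in>UNIV. Poly_Mapping.lookup \<gamma> i) = m + n"
    using assms by (simp add: homogeneous_polys_def lookup_add sum.distrib)
qed

lemma homogeneous_polys_Const: "Const c \<in> homogeneous_polys 0"
  by (auto simp: homogeneous_polys_def Const_def)

lemma homogeneous_polys_power:
  assumes "P \<in> homogeneous_polys m"
  shows "P ^ n \<in> homogeneous_polys (m * n)"
proof (induction n)
  case 0
  then show ?case by (simp add: homogeneous_polys_Const flip: Const_1)
next
  case (Suc n)
  then show ?case using homogeneous_polys_mult[OF assms Suc] by simp
qed

lemma homogeneous_polys_Var: "Var i \<in> homogeneous_polys 1"
proof -
  have "(\<Sum>j\<in>UNIV. Poly_Mapping.lookup (Poly_Mapping.single i (1::nat)) j)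
      = (\<Sum>j\<in>UNIV. if j = i then 1 else 0)"
    by (rule sum.cong) (auto simp: lookup_single when_def)
  then show ?thesis
    by (simp add: homogeneous_polys_def Var_def)
qed

lemma homogeneous_polys_row_times: "row_times M j \<in> homogeneous_polys 1"
  unfolding row_times_def
  using homogeneous_polys_mult[OF homogeneous_polys_Var homogeneous_polys_Const]
  by (intro homogeneous_polys_sum) auto

lemma homogeneous_polys_norm_power:
  "Const c * (\<Sum>i\<in>UNIV. Var i ^ 2) ^ p \<in> homogeneous_polys (2 * p)"
proof -
  have "(\<Sum>i\<in>UNIV. Var i ^ 2) \<in> homogeneous_polys 2"
    using homogeneous_polys_power[OF homogeneous_polys_Var, where n = 2]
    by (intro homogeneous_polys_sum) simp
  from homogeneous_polys_mult[OF homogeneous_polys_Const homogeneous_polys_power[OF this]]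
  show ?thesis by simp
qed

lemma norm_power_eq_sum_squares: "norm (x :: real ^ 'n) ^ (2 * p) = (\<Sum>i\<in>UNIV. (x $ i) ^ 2) ^ p"
  by (simp add: power_mult norm_vec_def L2_set_def sum_nonneg)

lemma eval_mpoly_norm_power:
  "eval_mpoly (Const c * (\<Sum>i\<in>UNIV. Var i ^ 2) ^ p) x = c * norm x ^ (2 * p)"
  by (simp add: eval_mpoly_simps norm_power_eq_sum_squares)

text \<open>
Differentiating a sum of \<open>m\<close>-th powers of linear forms in \<open>v\<close> trades one factor \<open>u \<bullet> v\<close> for the
coordinate \<open>u $ i\<close>, which can be absorbed into the weights. This drives the induction in the next lemma.
\<close>

lemma power_sum_partial_derivative:
  fixes u :: "'k \<Rightarrow> real ^ 'n"
  shows "((\<lambda>t. \<Sum>j\<in>L. c j * (u j \<bullet> (v + t *\<^sub>R axis i 1)) ^ Suc m) has_real_derivative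
    real (Suc m) * (\<Sum>j\<in>L. c j * u j $ i * (u j \<bullet> v) ^ m)) (at 0)"
  unfolding sum_distrib_left
proof (rule DERIV_sum)
  fix j
  have "((\<lambda>t. u j \<bullet> (v + t *\<^sub>R axis i 1)) has_real_derivative u j $ i) (at 0)"
    unfolding inner_add_right inner_scaleR_right inner_axis
    by (auto intro!: derivative_eq_intros)
  from DERIV_cmult[OF DERIV_power_Suc[OF this], of "c j" m]
  show "((\<lambda>t. c j * (u j \<bullet> (v + t *\<^sub>R axis i 1)) ^ Suc m) has_real_derivative
      real (Suc m) * (c j * u j $ i * (u j \<bullet> v) ^ m)) (at 0)"
    by (simp add: mult_ac)
qed

text \<open>
By the multinomial theorem the two sides of the hypothesis have the moments in the conclusion, up to a
common multinomial factor, as coefficients of the monomials in \<open>v\<close>. The coefficient is extracted by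
repeated differentiation in \<open>v\<close>, which is why the weights are arbitrary in the induction.
\<close>

lemma equal_power_sums_imp_equal_monomial_sums:
  fixes y :: "'i \<Rightarrow> real ^ 'n" and z :: "'j \<Rightarrow> real ^ 'n"
  assumes "\<And>v. (\<Sum>j\<in>J. a j * (y j \<bullet> v) ^ m) = (\<Sum>k\<in>K. b k * (z k \<bullet> v) ^ m)"
    and "(\<Sum>i\<in>UNIV. Poly_Mapping.lookup \<alpha> i) = m"
  shows "(\<Sum>j\<in>J. a j * monomial_at \<alpha> (y j)) = (\<Sum>k\<in>K. b k * monomial_at \<alpha> (z k))"
  using assms
proof (induction m arbitrary: a b \<alpha>)
  case 0
  then show ?case by (simp add: monomial_at_def)
next
  case (Suc m)
  let ?l = Poly_Mapping.lookup
  obtain i where i: "?l \<alpha> i > 0"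
    using Suc.prems(2) by (metis gr0I sum.neutral nat.distinct(1))
  \<comment> \<open>\<open>\<beta>\<close> is the exponent vector that remains after differentiating once in direction \<open>i\<close>.\<close>
  define \<beta> where "\<beta> = \<alpha> - Poly_Mapping.single i 1"
  have \<alpha>: "\<alpha> = Poly_Mapping.single i 1 + \<beta>"
    using i by (intro poly_mapping_eqI)
      (auto simp: \<beta>_def lookup_add lookup_minus lookup_single when_def)
  have "(\<Sum>j\<in>UNIV. ?l (Poly_Mapping.single i (1::nat)) j) = 1"
    using homogeneous_polys_Var[of i] by (auto simp: homogeneous_polys_def Var_def)
  then have \<beta>: "(\<Sum>i\<in>UNIV. ?l \<beta> i) = m"
    using Suc.prems(2) by (subst (asm) \<alpha>) (simp add: lookup_add sum.distrib)
  have mon: "monomial_at \<alpha> x = x $ i * monomial_at \<beta> x" for x :: "real ^ 'n"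
    using eval_mpoly_Var[of i x] by (subst \<alpha>) (simp add: monomial_at_add Var_def eval_mpoly_single)
  have "(\<Sum>j\<in>J. a j * y j $ i * (y j \<bullet> v) ^ m) = (\<Sum>k\<in>K. b k * z k $ i * (z k \<bullet> v) ^ m)" for v
    using DERIV_unique[OF
        power_sum_partial_derivative[where L = J and c = a and u = y and v = v and i = i and m = m]
        power_sum_partial_derivative[where L = K and c = b and u = z and v = v and i = i and m = m,
          folded Suc.prems(1)]]
    by simp
  from Suc.IH[OF this \<beta>] show ?case by (simp add: mon mult.assoc)
qed

lemma sum_eval_mpoly_by_monomials:
  "(\<Sum>j\<in>L. c j * eval_mpoly P (u j)) = (\<Sum>\<alpha>\<in>Poly_Mapping.keys P.
    Poly_Mapping.lookup P \<alpha> * (\<Sum>j\<in>L. c j * monomial_at \<alpha> (u j)))"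
  unfolding eval_mpoly_def sum_distrib_left
  by (subst sum.swap) (simp add: mult.left_commute)

lemma equal_power_sums_imp_equal_homogeneous_sums:
  fixes y :: "'i \<Rightarrow> real ^ 'n" and z :: "'j \<Rightarrow> real ^ 'n"
  assumes "\<And>v. (\<Sum>j\<in>J. a j * (y j \<bullet> v) ^ m) = (\<Sum>k\<in>K. b k * (z k \<bullet> v) ^ m)"
    and "P \<in> homogeneous_polys m"
  shows "(\<Sum>j\<in>J. a j * eval_mpoly P (y j)) = (\<Sum>k\<in>K. b k * eval_mpoly P (z k))"
  unfolding sum_eval_mpoly_by_monomials
  using assms(2) equal_power_sums_imp_equal_monomial_sums[OF assms(1)]
  by (intro sum.cong) (auto simp: homogeneous_polys_def)

section \<open>Orthogonal projections\<close>

lemma orthogonal_projection_unique: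
  fixes V :: "'a::euclidean_space set"
  assumes "subspace V" "y \<in> V" "\<And>v. v \<in> V \<Longrightarrow> (x - y) \<bullet> v = 0"
  shows "orthogonal_projection V x = y"
proof -
  let ?q = "orthogonal_projection V x"
  have q: "?q \<in> V" "\<forall>v\<in>V. (x - ?q) \<bullet> v = 0"
    using orthogonal_projection[OF assms(1)] by (auto simp: orthogonal_def)
  then have d: "y - ?q \<in> V" using assms by (simp add: subspace_diff)
  have "(y - ?q) \<bullet> (y - ?q) = (x - ?q) \<bullet> (y - ?q) - (x - y) \<bullet> (y - ?q)"
    by (simp add: inner_diff_left)
  also have "\<dots> = 0" using q d assms(3) by simp
  finally show ?thesis by simp
qed

lemma linear_orthogonal_projection:
  fixes V :: "'a::euclidean_space set"
  assumes "subspace V"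
  shows "linear (orthogonal_projection V)"
proof
  let ?P = "orthogonal_projection V"
  have P: "?P x \<in> V" "v \<in> V \<Longrightarrow> (x - ?P x) \<bullet> v = 0" for x v
    using orthogonal_projection[OF assms, of x] by (auto simp: orthogonal_def)
  show "?P (x + y) = ?P x + ?P y" for x y
  proof (rule orthogonal_projection_unique[OF assms])
    show "?P x + ?P y \<in> V" by (intro subspace_add assms P)
    show "(x + y - (?P x + ?P y)) \<bullet> v = 0" if "v \<in> V" for v
      using P(2)[OF that, of x] P(2)[OF that, of y]
      by (simp add: inner_diff_left inner_add_left)
  qed
  show "?P (c *\<^sub>R x) = c *\<^sub>R ?P x" for c x
  proof (rule orthogonal_projection_unique[OF assms])
    show "c *\<^sub>R ?P x \<in> V" by (intro subspace_scale assms P)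
    show "(c *\<^sub>R x - c *\<^sub>R ?P x) \<bullet> v = 0" if "v \<in> V" for v
      using P(2)[OF that, of x] by (simp add: inner_diff_left)
  qed
qed

lemma orthogonal_projection_id:
  fixes V :: "'a::euclidean_space set"
  shows "subspace V \<Longrightarrow> x \<in> V \<Longrightarrow> orthogonal_projection V x = x"
  by (intro orthogonal_projection_unique) auto

text \<open>
The scaling by \<open>norm v\<close> keeps the formula valid at \<open>v = 0\<close> and makes the right-hand side linear in \<open>v\<close> up
to the absolute value.
\<close>

lemma norm_orthogonal_projection_span:
  fixes v :: "'a::euclidean_space"
  shows "norm v * norm (orthogonal_projection (span {v}) x) = \<bar>x \<bullet> v\<bar>"
proof (cases "v = 0")
  case False
  have "orthogonal_projection (span {v}) x = ((x \<bullet> v) / (v \<bullet> v)) *\<^sub>R v"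
    using False
    by (intro orthogonal_projection_unique subspace_span)
      (auto simp: span_singleton inner_diff_left)
  then show ?thesis
    using False by (simp add: dot_square_norm power2_eq_square)
qed simp

text \<open>
An orthogonal map conjugates projections: the projection onto \<open>M V\<close> is \<open>M\<close> times the projection onto
\<open>V\<close> times the inverse of \<open>M\<close>, and the outer \<open>M\<close> preserves norms.
\<close>

lemma norm_orthogonal_projection_image:
  fixes M :: "real ^ 'n ^ 'n"
  assumes "orthogonal_matrix M" "subspace V"
  shows "norm (orthogonal_projection ((*v) M ` V) x) = norm (orthogonal_projection V (transpose M *v x))"
proof -
  let ?y = "transpose M *v x"
  note P = orthogonal_projection[OF assms(2), of ?y, unfolded orthogonal_def]
  have inner: "(M *v u) \<bullet> (M *v w) = u \<bullet> w" for u w :: "real ^ 'n"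
    using assms(1) orthogonal_transformation_matrix[of "(*v) M"]
    by (simp add: orthogonal_transformation_def)
  have x: "x = M *v ?y"
    using assms(1) by (metis matrix_vector_mul_assoc matrix_vector_mul_lid orthogonal_matrix_def)
  have "orthogonal_projection ((*v) M ` V) x = M *v orthogonal_projection V ?y"
  proof (rule orthogonal_projection_unique)
    show "subspace ((*v) M ` V)"
      using assms(2) by (intro linear_subspace_image) auto
    show "M *v orthogonal_projection V ?y \<in> (*v) M ` V" using P by auto
    fix v assume "v \<in> (*v) M ` V"
    then obtain w where w: "w \<in> V" "v = M *v w" by auto
    have "(x - M *v orthogonal_projection V ?y) \<bullet> v
        = (M *v (?y - orthogonal_projection V ?y)) \<bullet> (M *v w)"
      using x by (simp add: w matrix_vector_mult_diff_distrib)
    then show "(x - M *v orthogonal_projection V ?y) \<bullet> v = 0"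
      using P w by (simp add: inner)
  qed
  then show ?thesis by (simp add: norm_eq_sqrt_inner inner)
qed

lemma projection_norm_power_poly:
  fixes V :: "(real ^ 'n) set"
  assumes "subspace V"
  shows "\<exists>P\<in>homogeneous_polys (2 * p).
    \<forall>x. eval_mpoly P x = norm (orthogonal_projection V x) ^ (2 * p)"
proof -
  \<comment> \<open>Evaluation at \<open>x\<close> of the linear forms \<open>row_times M\<close> multiplies \<open>x\<close> by the transpose of \<open>M\<close>.\<close>
  define M where "M = transpose (matrix (orthogonal_projection V))"
  have "(\<Sum>i\<in>UNIV. row_times M i ^ 2) ^ p \<in> homogeneous_polys (2 * p)"
    using homogeneous_polys_power[OF homogeneous_polys_row_times, where n = 2]
    by (intro homogeneous_polys_power homogeneous_polys_sum) simp
  moreover have "eval_mpoly ((\<Sum>i\<in>UNIV. row_times M i ^ 2) ^ p) x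
      = norm (orthogonal_projection V x) ^ (2 * p)" for x
    using linear_orthogonal_projection[OF assms]
    by (simp add: eval_mpoly_simps eval_mpoly_row_times norm_power_eq_sum_squares M_def)
  ultimately show ?thesis by blast
qed

section \<open>Orbits of subspaces\<close>

lemma orthogonal_subgroup:
  assumes "subgroup G orthogonal_group"
  shows orthogonal_subgroup_orthogonal: "M \<in> G \<Longrightarrow> orthogonal_matrix M"
    and orthogonal_subgroup_mult: "M \<in> G \<Longrightarrow> N \<in> G \<Longrightarrow> M ** N \<in> G"
    and orthogonal_subgroup_one: "mat 1 \<in> G"
    and orthogonal_subgroup_transpose: "M \<in> G \<Longrightarrow> transpose M \<in> G"
proof -
  interpret subgroup G orthogonal_group by (rule assms)
  show orth: "M \<in> G \<Longrightarrow> orthogonal_matrix M" for M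
    using subset by (auto simp: orthogonal_group_def)
  show "M \<in> G \<Longrightarrow> N \<in> G \<Longrightarrow> M ** N \<in> G"
    using m_closed by (simp add: orthogonal_group_def)
  show "mat 1 \<in> G"
    using one_closed by (simp add: orthogonal_group_def)
  assume M: "M \<in> G"
  have "inv\<^bsub>orthogonal_group\<^esub> M = transpose M"
    using orth[OF M]
    by (intro group.inv_equality[OF group_orthogonal_group])
      (auto simp: orthogonal_group_def orthogonal_matrix_def)
  then show "transpose M \<in> G"
    using m_inv_closed[OF M] by simp
qed

lemma sum_orthogonal_subgroup_transpose:
  assumes "subgroup G orthogonal_group"
  shows "(\<Sum>g\<in>G. f (transpose g)) = (\<Sum>g\<in>G. f g)"
  by (rule sum.reindex_bij_witness[of _ transpose transpose])
    (auto simp: orthogonal_subgroup_transpose[OF assms])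

lemma image_matrix_vector_mult: "(*v) A ` (*v) B ` W = (*v) (A ** B) ` W"
  for A B :: "real ^ 'n ^ 'n"
  by (simp add: image_image matrix_vector_mul_assoc)

lemma subspace_orbit_closed:
  assumes "subgroup G orthogonal_group" "M \<in> G" "W \<in> subspace_orbit G V"
  shows "(*v) M ` W \<in> subspace_orbit G V"
proof -
  obtain g where "g \<in> G" "W = (*v) g ` V"
    using assms(3) by (auto simp: subspace_orbit_def)
  then have "(*v) M ` W = (*v) (M ** g) ` V" "M ** g \<in> G"
    using orthogonal_subgroup_mult[OF assms(1,2)] by (simp_all add: image_matrix_vector_mult)
  then show ?thesis
    unfolding subspace_orbit_def by blast
qed

lemma bij_betw_subspace_orbit:
  assumes "subgroup G orthogonal_group" "M \<in> G"
  shows "bij_betw ((`) ((*v) M)) (subspace_orbit G V) (subspace_orbit G V)"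
proof (rule bij_betw_byWitness[where f' = "(`) ((*v) (transpose M))"])
  note G = orthogonal_subgroup[OF assms(1)]
  have M: "M ** transpose M = mat 1" "transpose M ** M = mat 1"
    using G(1)[OF assms(2)] by (auto simp: orthogonal_matrix_def)
  show "\<forall>W\<in>subspace_orbit G V. (*v) (transpose M) ` (*v) M ` W = W"
    "\<forall>W\<in>subspace_orbit G V. (*v) M ` (*v) (transpose M) ` W = W"
    by (simp_all add: image_matrix_vector_mult M del: transpose_matrix_vector)
  show "(`) ((*v) M) ` subspace_orbit G V \<subseteq> subspace_orbit G V"
    "(`) ((*v) (transpose M)) ` subspace_orbit G V \<subseteq> subspace_orbit G V"
    using subspace_orbit_closed[OF assms(1)] G(4) assms(2) by blast+
qed

text \<open>
The frame condition sums over the orbit as a set, while averaging sums over the group. By the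
orbit-stabilizer argument every member of the orbit arises from equally many group elements, so the sums
differ by the factor \<open>s\<close>, the order of the stabilizer of \<open>V\<close>, the same for every function \<open>f\<close>.
\<close>

lemma sum_group_eq_sum_subspace_orbit:
  assumes "subgroup G orthogonal_group" "finite G"
  obtains s :: real where
    "\<And>f. (\<Sum>g\<in>G. f ((*v) g ` V)) = s * (\<Sum>W\<in>subspace_orbit G V. f W :: real)"
proof
  fix f :: "(real ^ 'a) set \<Rightarrow> real"
  note G = orthogonal_subgroup[OF assms(1)]
  let ?S = "\<lambda>W. {g\<in>G. (*v) g ` V = W}"
  have card: "card (?S W) = card (?S V)" if W: "W \<in> subspace_orbit G V" for W
  proof -
    obtain h where h: "h \<in> G" "W = (*v) h ` V"
      using W by (auto simp: subspace_orbit_def)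
    have o: "h ** transpose h = mat 1" "transpose h ** h = mat 1"
      using G(1)[OF h(1)] by (auto simp: orthogonal_matrix_def)
    have "bij_betw ((**) h) (?S V) (?S W)"
    proof (rule bij_betw_byWitness[where f' = "(**) (transpose h)"])
      show "(**) h ` ?S V \<subseteq> ?S W"
        using G(2) h by (simp add: image_subset_iff flip: image_matrix_vector_mult)
      show "(**) (transpose h) ` ?S W \<subseteq> ?S V"
      proof (intro image_subsetI CollectI conjI)
        fix g assume "g \<in> ?S W"
        then have g: "g \<in> G" "(*v) g ` V = (*v) h ` V" by (simp_all add: h)
        show "transpose h ** g \<in> G" using G(2,4) g(1) h(1) by simp
        have "(*v) (transpose h ** g) ` V = (*v) (transpose h) ` (*v) h ` V"
          by (simp only: g(2) flip: image_matrix_vector_mult)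
        also have "\<dots> = V"
          by (simp add: image_matrix_vector_mult o del: transpose_matrix_vector)
        finally show "(*v) (transpose h ** g) ` V = V" .
      qed
    qed (auto simp: matrix_mul_assoc o)
    then show ?thesis by (simp add: bij_betw_same_card)
  qed
  have orbit: "subspace_orbit G V = (\<lambda>g. (*v) g ` V) ` G"
    by (auto simp: subspace_orbit_def)
  have "(\<Sum>g\<in>G. f ((*v) g ` V))
      = (\<Sum>W\<in>subspace_orbit G V. \<Sum>g\<in>?S W. f ((*v) g ` V))"
    unfolding orbit by (rule sum.image_gen[OF assms(2)])
  also have "\<dots> = (\<Sum>W\<in>subspace_orbit G V. real (card (?S V)) * f W)"
    by (intro sum.cong) (auto simp: card)
  finally show "(\<Sum>g\<in>G. f ((*v) g ` V)) = real (card (?S V)) * (\<Sum>W\<in>subspace_orbit G V. f W)"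
    by (simp add: sum_distrib_left)
qed

lemma subspace_subspace_orbit:
  "subspace V \<Longrightarrow> W \<in> subspace_orbit G V \<Longrightarrow> subspace W"
  by (auto simp: subspace_orbit_def intro!: linear_subspace_image)

lemma eval_mpoly_invariant:
  assumes "subgroup G orthogonal_group" "P \<in> invariant_homogeneous_polys m G" "M \<in> G"
  shows "eval_mpoly P (M *v x) = eval_mpoly P x"
  using eval_mpoly_subst_row_times[of P "transpose M" x] assms
    orthogonal_subgroup_transpose[OF assms(1,3)]
  by (simp add: invariant_homogeneous_polys_def)

lemma invariant_homogeneous_polysI:
  fixes G :: "(real ^ 'n ^ 'n) set"
  assumes "P \<in> homogeneous_polys m" "\<And>M x. M \<in> G \<Longrightarrow> eval_mpoly P (transpose M *v x) = eval_mpoly P x"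
  shows "P \<in> invariant_homogeneous_polys m G"
  unfolding invariant_homogeneous_polys_def
  using assms by (auto intro!: eval_mpoly_inject simp: eval_mpoly_subst_row_times)

section \<open>Tight frames and invariants\<close>

text \<open>
The frame function is an invariant polynomial because applying a group element to its argument only
permutes the orbit.
\<close>

lemma tight_fusion_frame_orbit:
  fixes G :: "(real ^ 'n ^ 'n) set"
  assumes G: "subgroup G orthogonal_group" "finite G"
    and inv: "invariant_homogeneous_polys (2 * p) G = {Const c * (\<Sum>i\<in>UNIV. Var i ^ 2) ^ p | c. True}"
    and V: "subspace V" "dim V \<ge> 1"
  shows "tight_fusion_frame p (subspace_orbit G V) (\<lambda>W. W)"
proof -
  let ?O = "subspace_orbit G V"
  let ?f = "\<lambda>W x. norm (orthogonal_projection W x) ^ (2 * p)"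
  have fin: "finite ?O"
    unfolding subspace_orbit_def Setcompr_eq_image using G(2) by (rule finite_imageI)
  have sub: "subspace W" if "W \<in> ?O" for W
    using subspace_subspace_orbit[OF V(1) that] .
  have "\<forall>W\<in>?O. \<exists>P. P \<in> homogeneous_polys (2 * p) \<and> (\<forall>x. eval_mpoly P x = ?f W x)"
    using projection_norm_power_poly[OF sub, where p = p] unfolding Bex_def by blast
  from bchoice[OF this] obtain Q where Q:
      "\<And>W. W \<in> ?O \<Longrightarrow> Q W \<in> homogeneous_polys (2 * p)"
      "\<And>W x. W \<in> ?O \<Longrightarrow> eval_mpoly (Q W) x = ?f W x"
    by blast
  define P where "P = (\<Sum>W\<in>?O. Q W)"
  have eval: "eval_mpoly P x = (\<Sum>W\<in>?O. ?f W x)" for x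
    by (simp add: P_def eval_mpoly_sum Q)
  have "P \<in> invariant_homogeneous_polys (2 * p) G"
  proof (rule invariant_homogeneous_polysI)
    show "P \<in> homogeneous_polys (2 * p)"
      unfolding P_def by (rule homogeneous_polys_sum) (rule Q)
    fix M x assume M: "M \<in> G"
    have "(\<Sum>W\<in>?O. ?f W (transpose M *v x)) = (\<Sum>W\<in>?O. ?f ((*v) M ` W) x)"
      by (intro sum.cong refl)
        (simp add: norm_orthogonal_projection_image orthogonal_subgroup_orthogonal[OF G(1) M] sub)
    also have "\<dots> = (\<Sum>W\<in>?O. ?f W x)"
      using sum.reindex_bij_betw[OF bij_betw_subspace_orbit[OF G(1) M], of "\<lambda>W. ?f W x"] .
    finally show "eval_mpoly P (transpose M *v x) = eval_mpoly P x"
      by (simp add: eval)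
  qed
  then obtain c where c: "P = Const c * (\<Sum>i\<in>UNIV. Var i ^ 2) ^ p"
    unfolding inv by blast
  have frame: "(\<Sum>W\<in>?O. ?f W x) = c * norm x ^ (2 * p)" for x
    using eval[of x] by (simp only: c eval_mpoly_norm_power)
  have "V \<noteq> {0}" using V(2) by auto
  then obtain x where x: "x \<in> V" "x \<noteq> 0"
    using subspace_0[OF V(1)] by blast
  have "V \<in> ?O"
    using orthogonal_subgroup_one[OF G(1)] by (force simp: subspace_orbit_def)
  \<comment> \<open>Positivity of the frame constant: \<open>V\<close> itself contributes the full norm of \<open>x\<close>.\<close>
  then have "?f V x \<le> (\<Sum>W\<in>?O. ?f W x)"
    using fin by (intro member_le_sum) auto
  then have "norm x ^ (2 * p) \<le> c * norm x ^ (2 * p)"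
    using frame by (simp add: orthogonal_projection_id V x)
  moreover have "norm x ^ (2 * p) > 0" using x by simp
  ultimately have "c > 0" by (smt (verit) mult_nonpos_nonneg)
  then show ?thesis
    unfolding tight_fusion_frame_def using fin sub frame by (intro conjI ballI exI[of _ c]) auto
qed

text \<open>
The frame condition for the line through \<open>v\<close> makes the group sum a constant multiple of
\<open>norm x ^ (2 * p)\<close>, where the constant depends on \<open>v\<close> in an unknown way. Expressing that constant by the
value at \<open>e\<close> turns the right-hand side into a polynomial in \<open>v\<close> as well, so that coefficients in \<open>v\<close> can be
compared.
\<close>

lemma sum_group_inner_power:
  fixes G :: "(real ^ 'n ^ 'n) set"
  assumes G: "subgroup G orthogonal_group" "finite G" and "p \<ge> 1"
    and frames: "\<And>v. v \<noteq> 0 \<Longrightarrow> tight_fusion_frame p (subspace_orbit G (span {v})) (\<lambda>W. W)"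
    and e: "norm e = 1"
  shows "(\<Sum>g\<in>G. ((g *v x) \<bullet> v) ^ (2 * p)) = norm x ^ (2 * p) * (\<Sum>g\<in>G. ((g *v e) \<bullet> v) ^ (2 * p))"
proof (cases "v = 0")
  case True
  then show ?thesis using \<open>p \<ge> 1\<close> by (simp add: power_0_left)
next
  case False
  let ?f = "\<lambda>W x. norm (orthogonal_projection W x) ^ (2 * p)"
  obtain A where A: "\<And>x. (\<Sum>W\<in>subspace_orbit G (span {v}). ?f W x) = A * norm x ^ (2 * p)"
    using frames[OF False] by (auto simp: tight_fusion_frame_def)
  obtain s :: real where s: "\<And>f. (\<Sum>g\<in>G. f ((*v) g ` span {v}))
      = s * (\<Sum>W\<in>subspace_orbit G (span {v}). f W)"
    using sum_group_eq_sum_subspace_orbit[OF G] by blast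
  have "(\<Sum>g\<in>G. ((g *v x) \<bullet> v) ^ (2 * p)) = norm v ^ (2 * p) * s * A * norm x ^ (2 * p)" for x
  proof -
    have proj: "((transpose g *v x) \<bullet> v) ^ (2 * p) = norm v ^ (2 * p) * ?f ((*v) g ` span {v}) x"
      if "g \<in> G" for g
    proof -
      have "((transpose g *v x) \<bullet> v) ^ (2 * p) = \<bar>(transpose g *v x) \<bullet> v\<bar> ^ (2 * p)"
        by (simp add: power_even_abs)
      also have "\<dots> = (norm v * norm (orthogonal_projection (span {v}) (transpose g *v x))) ^ (2 * p)"
        by (simp only: norm_orthogonal_projection_span)
      also have "\<dots> = norm v ^ (2 * p) * ?f ((*v) g ` span {v}) x"
        by (simp only: power_mult_distrib norm_orthogonal_projection_image[OF
            orthogonal_subgroup_orthogonal[OF G(1) that] subspace_span])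
      finally show ?thesis .
    qed
    \<comment> \<open>Projecting \<open>x\<close> onto \<open>g v\<close> produces the inverse of \<open>g\<close>, so the sum runs over inverses.\<close>
    have "(\<Sum>g\<in>G. ((g *v x) \<bullet> v) ^ (2 * p)) = (\<Sum>g\<in>G. ((transpose g *v x) \<bullet> v) ^ (2 * p))"
      by (rule sum_orthogonal_subgroup_transpose[OF G(1), symmetric])
    also have "\<dots> = norm v ^ (2 * p) * (\<Sum>g\<in>G. ?f ((*v) g ` span {v}) x)"
      by (simp only: proj sum_distrib_left cong: sum.cong)
    finally show ?thesis
      using s[of "\<lambda>W. ?f W x"] by (simp add: A)
  qed
  from this[of x] this[of e] e show ?thesis by simp
qed

theorem theorem6p1:
  fixes G :: "(real ^ 'n ^ 'n) set" and p :: nat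
  assumes "p \<ge> 1" and "CARD('n) \<ge> 2"
    and "subgroup G orthogonal_group" and "finite G"
  shows "(\<forall>k V. 1 \<le> k \<and> k < CARD('n) \<and> subspace V \<and> dim V = k \<longrightarrow>
            tight_fusion_frame p (subspace_orbit G V) (\<lambda>W. W))
     \<longleftrightarrow> invariant_homogeneous_polys (2 * p) G =
           {Const c * (\<Sum>i\<in>UNIV. Var i ^ 2) ^ p | c. True}"
    (is "?frames \<longleftrightarrow> ?invariants")
proof
  assume ?invariants
  from tight_fusion_frame_orbit[OF assms(3,4) this] show ?frames by auto
next
  assume frames: ?frames
  show ?invariants
  proof (intro equalityI subsetI)
    fix P assume P: "P \<in> invariant_homogeneous_polys (2 * p) G"
    \<comment> \<open>Any unit vector serves as the reference point.\<close>
    define e :: "real ^ 'n" where "e = axis undefined 1"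
    have e: "norm e = 1" by (simp add: e_def)
    \<comment> \<open>Lines are proper subspaces because the dimension is at least 2.\<close>
    have lines: "tight_fusion_frame p (subspace_orbit G (span {v})) (\<lambda>W. W)" if "v \<noteq> 0" for v
    proof -
      have "dim (span {v}) = 1" using that by (simp add: dim_eq_card_independent)
      then show ?thesis
        using frames[rule_format, of 1 "span {v}"] assms(2) subspace_span by simp
    qed
    have hom: "P \<in> homogeneous_polys (2 * p)"
      using P by (simp add: invariant_homogeneous_polys_def)
    have eval: "eval_mpoly P x = norm x ^ (2 * p) * eval_mpoly P e" for x
    proof -
      have "(\<Sum>g\<in>G. 1 * eval_mpoly P (g *v x)) = (\<Sum>g\<in>G. norm x ^ (2 * p) * eval_mpoly P (g *v e))"
      proof (rule equal_power_sums_imp_equal_homogeneous_sums[OF _ hom])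
        show "(\<Sum>g\<in>G. 1 * ((g *v x) \<bullet> v) ^ (2 * p))
            = (\<Sum>g\<in>G. norm x ^ (2 * p) * ((g *v e) \<bullet> v) ^ (2 * p))" for v
          unfolding mult_1 sum_distrib_left[symmetric]
          using lines by (rule sum_group_inner_power[OF assms(3,4,1) _ e])
      qed
      then have "real (card G) * eval_mpoly P x
          = real (card G) * (norm x ^ (2 * p) * eval_mpoly P e)"
        by (simp add: eval_mpoly_invariant[OF assms(3) P])
      moreover have "card G \<noteq> 0"
        using orthogonal_subgroup_one[OF assms(3)] assms(4) by auto
      ultimately show ?thesis by simp
    qed
    have "P = Const (eval_mpoly P e) * (\<Sum>i\<in>UNIV. Var i ^ 2) ^ p"
    proof (rule eval_mpoly_inject)
      show "eval_mpoly P x = eval_mpoly (Const (eval_mpoly P e) * (\<Sum>i\<in>UNIV. Var i ^ 2) ^ p) x" for x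
        unfolding eval_mpoly_norm_power using eval[of x] by (simp only: mult.commute)
    qed
    then show "P \<in> {Const c * (\<Sum>i\<in>UNIV. Var i ^ 2) ^ p | c. True}" by blast
  next
    fix P :: "('n, real) mpoly"
    assume "P \<in> {Const c * (\<Sum>i\<in>UNIV. Var i ^ 2) ^ p | c. True}"
    then obtain c where c: "P = Const c * (\<Sum>i\<in>UNIV. Var i ^ 2) ^ p" by blast
    show "P \<in> invariant_homogeneous_polys (2 * p) G"
    proof (rule invariant_homogeneous_polysI)
      show "P \<in> homogeneous_polys (2 * p)"
        unfolding c by (rule homogeneous_polys_norm_power)
      fix M x assume "M \<in> G"
      then have "orthogonal_transformation ((*v) (transpose M))"
        using orthogonal_subgroup[OF assms(3)] by (simp add: orthogonal_transformation_matrix)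
      then have "norm (transpose M *v x) = norm x"
        by (rule orthogonal_transformation_norm)
      then show "eval_mpoly P (transpose M *v x) = eval_mpoly P x"
        unfolding c eval_mpoly_norm_power by simp
    qed
  qed
qed

end
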